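(* Let $\mathbb{F}$ be an arbitrary field, let $n=n_1+n_2$, and let $A=A_1\oplus A_2\in\mathbb{F}^{n\times n}$ with $A_i\in\mathbb{F}^{n_i\times n_i}$, $i=1,2$. Let $x,y\in\mathbb{F}^{n\times 1}$ and split $$B=A+xy^T=\begin{bmatrix} B_{11} & B_{12} \\ B_{21} & B_{22} \end{bmatrix}$$ into $2\times2$ blocks such that $B_{ii}\in\mathbb{F}^{n_i\times n_i}$, $i=1,2$. Assume also that the eigenvalues of $A_1$ and of $A_2$ have geometric multiplicity equal to $1$ (each eigenvalue of $A_i$ having geometric multiplicity $1$ as an eigenvalue of $A_i$) and that $$\Lambda(A_1)\cap\Lambda(B_{11})=\Lambda(A_2)\cap\Lambda(B_{22})=\emptyset.$$ Then $$\Lambda(A_1)\cap\Lambda(A_2)=\Lambda(B)\cap\Lambda(A_1)=\Lambda(B)\cap\Lambda(A_2).$$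
   Context: For a square matrix $M$ over $\mathbb{F}$, $\Lambda(M)$ denotes the set of eigenvalues (spectrum) of $M$ in, perhaps, an extension field of $\mathbb{F}$, i.e. the set of all roots of $\det(\lambda I-M)$ (e.g. in a fixed algebraic closure of $\mathbb{F}$); geometric multiplicities are computed over that extension field. $A_1\oplus A_2$ denotes the block diagonal matrix with diagonal blocks $A_1$ and $A_2$. *)

theory Defs
  imports
    "HOL-Algebra.Algebraic_Closure_Type"
    "Jordan_Normal_Form.Matrix_Kernel"
    "Jordan_Normal_Form.Spectral_Radius"
begin

text \<open>Eigenvalues are taken in the algebraic closure of the base field; entries are moved there
  by the embedding \<^const>\<open>to_ac\<close>.\<close>

definition closure_mat :: "'a::field mat \<Rightarrow> 'a alg_closure mat" where
  "closure_mat M = map_mat to_ac M"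

definition closure_spectrum :: "'a::field mat \<Rightarrow> 'a alg_closure set" where
  "closure_spectrum M = spectrum (closure_mat M)"

text \<open>The kernel of \<^term>\<open>char_matrix N e\<close>, that is, of $N - eI$, is the eigenspace of \<open>N\<close> at \<open>e\<close>.\<close>

definition geom_mult :: "'a::field mat \<Rightarrow> 'a alg_closure \<Rightarrow> nat" where
  "geom_mult M e = kernel_dim (char_matrix (closure_mat M) e)"

lemma comm_ring_hom_to_ac: "comm_ring_hom (to_ac :: 'a::field \<Rightarrow> 'a alg_closure)"
  by unfold_locales simp_all

lemma closure_spectrum_eq_roots_char_poly:
  fixes M :: "'a::field mat"
  assumes "M \<in> carrier_mat n n"
  shows "closure_spectrum M = {e. poly (map_poly to_ac (char_poly M)) e = 0}"
proof -
  have "closure_mat M \<in> carrier_mat n n"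
    using assms by (simp add: closure_mat_def)
  then have "closure_spectrum M = {e. poly (char_poly (closure_mat M)) e = 0}"
    unfolding closure_spectrum_def by (rule spectrum_root_char_poly)
  then show ?thesis
    by (simp add: closure_mat_def comm_ring_hom.char_poly_hom[OF comm_ring_hom_to_ac assms])
qed

end

theory Submission
  imports Defs
begin

text \<open>
  Over the algebraic closure, an eigenvector of $A_1 \oplus A_2 + x y^T$ at $e$ is a nonzero pair
  $(v_1, v_2)$ such that $A_i v_i + c x_i = e v_i$ for $i = 1, 2$, where
  $c = y_1^T v_1 + y_2^T v_2$. The diagonal blocks of the perturbed matrix are
  $B_{ii} = A_i + x_i y_i^T$.

  Suppose that $e$ is an eigenvalue of $A_1$ but not of $B_{11}$. Then no eigenvector $u$ of
  $A_1$ at $e$ is orthogonal to $y_1$, since $B_{11} u = A_1 u + (y_1^T u) x_1$; and $x_1$ does not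
  lie in the range of $A_1 - e I$, so that the first equation above forces $c = 0$
  (\<open>rank_one_moves_eigenvalue_imp_coupling_zero\<close>). Now each $v_i$ lies in the kernel of
  $A_i - e I$. If $v_2$ were zero, $v_1$ would be an eigenvector of $A_1$ orthogonal to $y_1$,
  which is impossible; so $e$ is an eigenvalue of $A_2$. By symmetry, a common eigenvalue of $B$
  and of one summand is an eigenvalue of the other summand.

  Conversely, let $e$ be an eigenvalue of both summands, with eigenvectors $u_1$ and $u_2$. In the
  plane spanned by $(u_1, 0)$ and $(0, u_2)$, which consists of solutions of the uncoupled
  equations, some nonzero vector is orthogonal to $y$. The rank-one term kills this vector, so it is
  an eigenvector of $B$. Thus any two of the conditions that $e$ belong to the spectrum of $A_1$, of
  $A_2$ and of $B$ imply the third.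
\<close>

section \<open>Rank-one matrices\<close>

definition outer_product :: "'k::field vec \<Rightarrow> 'k vec \<Rightarrow> 'k mat" where
  "outer_product a b = mat (dim_vec a) (dim_vec b) (\<lambda>(i, j). a $ i * b $ j)"

lemma outer_product_carrier:
  assumes "a \<in> carrier_vec n" "b \<in> carrier_vec m"
  shows "outer_product a b \<in> carrier_mat n m"
  using assms by (auto simp: outer_product_def)

lemma rank_one_perturbation_carrier:
  assumes "a \<in> carrier_vec n" "b \<in> carrier_vec m"
  shows "M + outer_product a b \<in> carrier_mat n m"
  using outer_product_carrier[OF assms] by (rule add_carrier_mat)

lemma outer_product_mult_vec:
  fixes a b v :: "'k::field vec"
  assumes "a \<in> carrier_vec n" "b \<in> carrier_vec m" "v \<in> carrier_vec m"
  shows "outer_product a b *\<^sub>v v = (b \<bullet> v) \<cdot>\<^sub>v a"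
  using assms
  by (intro eq_vecI)
    (auto simp: outer_product_def scalar_prod_def sum_distrib_right sum_distrib_left ac_simps)

lemma rank_one_perturbation_mult_vec:
  fixes M :: "'k::field mat"
  assumes "M \<in> carrier_mat n n" "a \<in> carrier_vec n" "b \<in> carrier_vec n" "v \<in> carrier_vec n"
  shows "(M + outer_product a b) *\<^sub>v v = M *\<^sub>v v + (b \<bullet> v) \<cdot>\<^sub>v a"
  using assms
  by (simp add: add_mult_distrib_mat_vec[OF _ outer_product_carrier] outer_product_mult_vec)

lemma smult_append_vec: "c \<cdot>\<^sub>v (v @\<^sub>v w) = (c \<cdot>\<^sub>v v) @\<^sub>v (c \<cdot>\<^sub>v w)"
  by (intro eq_vecI) auto

text \<open>Splitting the vectors as well lets both diagonal blocks be treated symmetrically.\<close>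

lemma block_diagonal_perturbation_mult_vec:
  fixes M1 M2 :: "'k::field mat"
  assumes M: "M1 \<in> carrier_mat n1 n1" "M2 \<in> carrier_mat n2 n2"
    and a: "a1 \<in> carrier_vec n1" "a2 \<in> carrier_vec n2"
    and b: "b1 \<in> carrier_vec n1" "b2 \<in> carrier_vec n2"
    and v: "v1 \<in> carrier_vec n1" "v2 \<in> carrier_vec n2"
  defines "c \<equiv> b1 \<bullet> v1 + b2 \<bullet> v2"
  shows "(four_block_mat M1 (0\<^sub>m n1 n2) (0\<^sub>m n2 n1) M2 + outer_product (a1 @\<^sub>v a2) (b1 @\<^sub>v b2))
      *\<^sub>v (v1 @\<^sub>v v2) = (M1 *\<^sub>v v1 + c \<cdot>\<^sub>v a1) @\<^sub>v (M2 *\<^sub>v v2 + c \<cdot>\<^sub>v a2)"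
proof -
  have "four_block_mat M1 (0\<^sub>m n1 n2) (0\<^sub>m n2 n1) M2 *\<^sub>v (v1 @\<^sub>v v2) =
      (M1 *\<^sub>v v1 + 0\<^sub>m n1 n2 *\<^sub>v v2) @\<^sub>v (0\<^sub>m n2 n1 *\<^sub>v v1 + M2 *\<^sub>v v2)"
    using M v by (intro four_block_mat_mult_vec) auto
  also have "\<dots> = (M1 *\<^sub>v v1) @\<^sub>v (M2 *\<^sub>v v2)"
    using M v by (intro arg_cong2[of _ _ _ _ append_vec] eq_vecI) (auto simp: scalar_prod_def)
  finally have block: "four_block_mat M1 (0\<^sub>m n1 n2) (0\<^sub>m n2 n1) M2 *\<^sub>v (v1 @\<^sub>v v2) =
      (M1 *\<^sub>v v1) @\<^sub>v (M2 *\<^sub>v v2)" .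
  have "(b1 @\<^sub>v b2) \<bullet> (v1 @\<^sub>v v2) = c"
    unfolding c_def using b v by (rule scalar_prod_append)
  moreover have "four_block_mat M1 (0\<^sub>m n1 n2) (0\<^sub>m n2 n1) M2 \<in> carrier_mat (n1 + n2) (n1 + n2)"
    using M by simp
  ultimately have "(four_block_mat M1 (0\<^sub>m n1 n2) (0\<^sub>m n2 n1) M2
        + outer_product (a1 @\<^sub>v a2) (b1 @\<^sub>v b2)) *\<^sub>v (v1 @\<^sub>v v2) =
      ((M1 *\<^sub>v v1) @\<^sub>v (M2 *\<^sub>v v2)) + c \<cdot>\<^sub>v (a1 @\<^sub>v a2)"
    using rank_one_perturbation_mult_vec[OF _ append_carrier_vec[OF a] append_carrier_vec[OF b]
        append_carrier_vec[OF v]] block by simp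
  also have "c \<cdot>\<^sub>v (a1 @\<^sub>v a2) = (c \<cdot>\<^sub>v a1) @\<^sub>v (c \<cdot>\<^sub>v a2)"
    by (rule smult_append_vec)
  also have "((M1 *\<^sub>v v1) @\<^sub>v (M2 *\<^sub>v v2)) + \<dots> =
      (M1 *\<^sub>v v1 + c \<cdot>\<^sub>v a1) @\<^sub>v (M2 *\<^sub>v v2 + c \<cdot>\<^sub>v a2)"
    using M a v by (intro append_vec_add) auto
  finally show ?thesis .
qed

section \<open>Eigenvalues moved by a rank-one perturbation\<close>

lemma eigenvalueI:
  fixes M :: "'k::field mat"
  assumes "M \<in> carrier_mat n n" "v \<in> carrier_vec n" "v \<noteq> 0\<^sub>v n" "M *\<^sub>v v = e \<cdot>\<^sub>v v"
  shows "eigenvalue M e"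
  using assms unfolding eigenvalue_def eigenvector_def by (intro exI[of _ v]) simp

lemma eigenvalueE:
  fixes M :: "'k::field mat"
  assumes "eigenvalue M e" "M \<in> carrier_mat n n"
  obtains v where "v \<in> carrier_vec n" "v \<noteq> 0\<^sub>v n" "M *\<^sub>v v = e \<cdot>\<^sub>v v"
  using assms unfolding eigenvalue_def eigenvector_def by auto

lemma rank_one_moves_eigenvalue_imp_not_orthogonal:
  fixes M :: "'k::field mat"
  assumes M: "M \<in> carrier_mat n n" "a \<in> carrier_vec n" "b \<in> carrier_vec n"
    and moved: "\<not> eigenvalue (M + outer_product a b) e"
    and u: "u \<in> carrier_vec n" "u \<noteq> 0\<^sub>v n" "M *\<^sub>v u = e \<cdot>\<^sub>v u"
  shows "b \<bullet> u \<noteq> 0"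
proof
  assume "b \<bullet> u = 0"
  with M u have "(M + outer_product a b) *\<^sub>v u = e \<cdot>\<^sub>v u"
    by (simp add: rank_one_perturbation_mult_vec) (auto intro!: eq_vecI)
  with M u moved show False
    using eigenvalueI[OF rank_one_perturbation_carrier] by blast
qed

text \<open>
  The hypothesis on \<open>v\<close> says that \<open>c \<cdot>\<^sub>v a\<close> lies in the range of $M - e I$. Shifting \<open>v\<close> along an
  eigenvector \<open>u\<close> of \<open>M\<close> keeps this equation, and since \<open>b \<bullet> u \<noteq> 0\<close> the shift can make the scalar
  product with \<open>b\<close> equal to \<open>c\<close>. If \<open>c\<close> were nonzero, the shifted vector would be an eigenvector of
  the perturbed matrix.
\<close>

lemma rank_one_moves_eigenvalue_imp_coupling_zero:
  fixes M :: "'k::field mat"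
  assumes M: "M \<in> carrier_mat n n" and a: "a \<in> carrier_vec n" and b: "b \<in> carrier_vec n"
    and eig: "eigenvalue M e" and moved: "\<not> eigenvalue (M + outer_product a b) e"
    and v: "v \<in> carrier_vec n" "M *\<^sub>v v + c \<cdot>\<^sub>v a = e \<cdot>\<^sub>v v"
  shows "c = 0"
proof (rule ccontr)
  assume "c \<noteq> 0"
  obtain u where u: "u \<in> carrier_vec n" "u \<noteq> 0\<^sub>v n" "M *\<^sub>v u = e \<cdot>\<^sub>v u"
    using eig M by (rule eigenvalueE)
  have bu: "b \<bullet> u \<noteq> 0"
    using M a b moved u by (rule rank_one_moves_eigenvalue_imp_not_orthogonal)
  define t where "t = (c - b \<bullet> v) / (b \<bullet> u)"
  define z where "z = v + t \<cdot>\<^sub>v u"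
  have z: "z \<in> carrier_vec n"
    using u v by (simp add: z_def)
  have bz: "b \<bullet> z = c"
    using b u v bu by (simp add: z_def t_def scalar_prod_add_distrib[of _ n])
  with b \<open>c \<noteq> 0\<close> have "z \<noteq> 0\<^sub>v n"
    by auto
  have "M *\<^sub>v z = M *\<^sub>v v + (t * e) \<cdot>\<^sub>v u"
    using M u v by (simp add: z_def mult_add_distrib_mat_vec mult_mat_vec smult_smult_assoc)
  then have "(M + outer_product a b) *\<^sub>v z = (M *\<^sub>v v + (t * e) \<cdot>\<^sub>v u) + c \<cdot>\<^sub>v a"
    using M a b z bz by (simp add: rank_one_perturbation_mult_vec)
  also have "\<dots> = (M *\<^sub>v v + c \<cdot>\<^sub>v a) + (t * e) \<cdot>\<^sub>v u"
    using M a u v(1) by (intro eq_vecI) auto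
  also have "\<dots> = e \<cdot>\<^sub>v z"
    unfolding v(2) z_def using u v(1) by (intro eq_vecI) (auto simp: algebra_simps)
  finally have "eigenvalue (M + outer_product a b) e"
    using a b z \<open>z \<noteq> 0\<^sub>v n\<close> by (intro eigenvalueI[OF rank_one_perturbation_carrier])
  with moved show False ..
qed

section \<open>Coupling two matrices by a rank-one perturbation\<close>

text \<open>
  The equations that a pair satisfies when it is an eigenvector of the perturbed direct sum. Unlike
  the block matrix, the pair of equations is invariant under exchanging the two summands.
\<close>

definition coupled_eigenpair ::
  "'k::field mat \<Rightarrow> 'k vec \<Rightarrow> 'k vec \<Rightarrow> 'k mat \<Rightarrow> 'k vec \<Rightarrow> 'k vec \<Rightarrow> 'k \<Rightarrow> 'k vec \<Rightarrow> 'k vec \<Rightarrow> bool"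
where
  "coupled_eigenpair M1 a1 b1 M2 a2 b2 e v1 v2 \<longleftrightarrow>
    (let c = b1 \<bullet> v1 + b2 \<bullet> v2 in
      v1 \<in> carrier_vec (dim_row M1) \<and> v2 \<in> carrier_vec (dim_row M2) \<and>
      (v1 \<noteq> 0\<^sub>v (dim_row M1) \<or> v2 \<noteq> 0\<^sub>v (dim_row M2)) \<and>
      M1 *\<^sub>v v1 + c \<cdot>\<^sub>v a1 = e \<cdot>\<^sub>v v1 \<and> M2 *\<^sub>v v2 + c \<cdot>\<^sub>v a2 = e \<cdot>\<^sub>v v2)"

lemma coupled_eigenpair_swap:
  "coupled_eigenpair M1 a1 b1 M2 a2 b2 e v1 v2 \<Longrightarrow> coupled_eigenpair M2 a2 b2 M1 a1 b1 e v2 v1"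
  by (auto simp: coupled_eigenpair_def Let_def add.commute)

lemma eigenvalue_block_diagonal_perturbation_iff:
  fixes M1 M2 :: "'k::field mat"
  assumes M: "M1 \<in> carrier_mat n1 n1" "M2 \<in> carrier_mat n2 n2"
    and a: "a1 \<in> carrier_vec n1" "a2 \<in> carrier_vec n2"
    and b: "b1 \<in> carrier_vec n1" "b2 \<in> carrier_vec n2"
  shows "eigenvalue (four_block_mat M1 (0\<^sub>m n1 n2) (0\<^sub>m n2 n1) M2
      + outer_product (a1 @\<^sub>v a2) (b1 @\<^sub>v b2)) e
    \<longleftrightarrow> (\<exists>v1 v2. coupled_eigenpair M1 a1 b1 M2 a2 b2 e v1 v2)"
    (is "eigenvalue ?N e \<longleftrightarrow> _")
proof -
  have N: "?N \<in> carrier_mat (n1 + n2) (n1 + n2)"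
    using a b by (intro rank_one_perturbation_carrier append_carrier_vec)
  have eigen_iff: "eigenvector ?N (v1 @\<^sub>v v2) e \<longleftrightarrow> coupled_eigenpair M1 a1 b1 M2 a2 b2 e v1 v2"
    if v: "v1 \<in> carrier_vec n1" "v2 \<in> carrier_vec n2" for v1 v2
  proof -
    have zero: "(0\<^sub>v (n1 + n2) :: 'k vec) = 0\<^sub>v n1 @\<^sub>v 0\<^sub>v n2"
      by (intro eq_vecI) auto
    have split: "p1 @\<^sub>v p2 = q1 @\<^sub>v q2 \<longleftrightarrow> p1 = q1 \<and> p2 = q2"
      if "p1 \<in> carrier_vec n1" "q1 \<in> carrier_vec n1" for p1 q1 p2 q2 :: "'k vec"
      using that by (rule append_vec_eq)
    show ?thesis
      unfolding eigenvector_def carrier_matD(1)[OF N]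
      using M a v
      by (simp add: coupled_eigenpair_def Let_def zero smult_append_vec split
          block_diagonal_perturbation_mult_vec[OF M a b v])
  qed
  show ?thesis
  proof
    assume "eigenvalue ?N e"
    then obtain v where v: "eigenvector ?N v e"
      by (auto simp: eigenvalue_def)
    then have "v \<in> carrier_vec (n1 + n2)"
      unfolding eigenvector_def carrier_matD(1)[OF N] by blast
    then have "vec_first v n1 @\<^sub>v vec_last v n2 = v"
      by (rule vec_first_last_append)
    with v eigen_iff[of "vec_first v n1" "vec_last v n2"]
    show "\<exists>v1 v2. coupled_eigenpair M1 a1 b1 M2 a2 b2 e v1 v2"
      by auto
  next
    assume "\<exists>v1 v2. coupled_eigenpair M1 a1 b1 M2 a2 b2 e v1 v2"
    then obtain v1 v2 where v: "coupled_eigenpair M1 a1 b1 M2 a2 b2 e v1 v2"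
      by blast
    then have "v1 \<in> carrier_vec n1" "v2 \<in> carrier_vec n2"
      using M by (auto simp: coupled_eigenpair_def Let_def)
    with v eigen_iff show "eigenvalue ?N e"
      unfolding eigenvalue_def by blast
  qed
qed

text \<open>The coupling vanishes, and the first component cannot carry the eigenvector alone.\<close>

lemma coupled_eigenpair_imp_eigenvalue_second:
  fixes M1 M2 :: "'k::field mat"
  assumes M: "M1 \<in> carrier_mat n1 n1" "M2 \<in> carrier_mat n2 n2"
    and a: "a1 \<in> carrier_vec n1" "a2 \<in> carrier_vec n2"
    and b: "b1 \<in> carrier_vec n1" "b2 \<in> carrier_vec n2"
    and eig: "eigenvalue M1 e" and moved: "\<not> eigenvalue (M1 + outer_product a1 b1) e"
    and pair: "coupled_eigenpair M1 a1 b1 M2 a2 b2 e v1 v2"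
  shows "eigenvalue M2 e"
proof -
  define c where "c = b1 \<bullet> v1 + b2 \<bullet> v2"
  have v: "v1 \<in> carrier_vec n1" "v2 \<in> carrier_vec n2" "v1 \<noteq> 0\<^sub>v n1 \<or> v2 \<noteq> 0\<^sub>v n2"
    and eq: "M1 *\<^sub>v v1 + c \<cdot>\<^sub>v a1 = e \<cdot>\<^sub>v v1" "M2 *\<^sub>v v2 + c \<cdot>\<^sub>v a2 = e \<cdot>\<^sub>v v2"
    using pair M by (auto simp: coupled_eigenpair_def Let_def c_def)
  have c: "c = 0"
    using M(1) a(1) b(1) eig moved v(1) eq(1)
    by (rule rank_one_moves_eigenvalue_imp_coupling_zero)
  have "M1 *\<^sub>v v1 = M1 *\<^sub>v v1 + c \<cdot>\<^sub>v a1" "M2 *\<^sub>v v2 = M2 *\<^sub>v v2 + c \<cdot>\<^sub>v a2"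
    using M a v c by (auto intro!: eq_vecI)
  then have uncoupled: "M1 *\<^sub>v v1 = e \<cdot>\<^sub>v v1" "M2 *\<^sub>v v2 = e \<cdot>\<^sub>v v2"
    using eq by simp_all
  have "v2 \<noteq> 0\<^sub>v n2"
  proof
    assume "v2 = 0\<^sub>v n2"
    with c b have "b1 \<bullet> v1 = 0"
      by (simp add: c_def)
    moreover have "b1 \<bullet> v1 \<noteq> 0"
      using M(1) a(1) b(1) moved v(1) _ uncoupled(1)
      by (rule rank_one_moves_eigenvalue_imp_not_orthogonal) (use v(3) \<open>v2 = 0\<^sub>v n2\<close> in simp)
    ultimately show False by simp
  qed
  then show ?thesis
    using M v uncoupled by (intro eigenvalueI[of _ n2 v2]) auto
qed

lemma common_eigenvalue_imp_coupled_eigenpair: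
  fixes M1 M2 :: "'k::field mat"
  assumes M: "M1 \<in> carrier_mat n1 n1" "M2 \<in> carrier_mat n2 n2"
    and a: "a1 \<in> carrier_vec n1" "a2 \<in> carrier_vec n2"
    and b: "b1 \<in> carrier_vec n1" "b2 \<in> carrier_vec n2"
    and eig: "eigenvalue M1 e" "eigenvalue M2 e"
    and moved: "\<not> eigenvalue (M2 + outer_product a2 b2) e"
  shows "\<exists>v1 v2. coupled_eigenpair M1 a1 b1 M2 a2 b2 e v1 v2"
proof -
  obtain u1 where u1: "u1 \<in> carrier_vec n1" "u1 \<noteq> 0\<^sub>v n1" "M1 *\<^sub>v u1 = e \<cdot>\<^sub>v u1"
    using eig(1) M(1) by (rule eigenvalueE)
  obtain u2 where u2: "u2 \<in> carrier_vec n2" "u2 \<noteq> 0\<^sub>v n2" "M2 *\<^sub>v u2 = e \<cdot>\<^sub>v u2"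
    using eig(2) M(2) by (rule eigenvalueE)
  have bu2: "b2 \<bullet> u2 \<noteq> 0"
    using M(2) a(2) b(2) moved u2 by (rule rank_one_moves_eigenvalue_imp_not_orthogonal)
  \<comment> \<open>The coefficient makes the pair \<open>(u1, v2)\<close> orthogonal to \<open>(b1, b2)\<close>.\<close>
  define t where "t = - (b1 \<bullet> u1) / (b2 \<bullet> u2)"
  define v2 where "v2 = t \<cdot>\<^sub>v u2"
  have v2: "v2 \<in> carrier_vec n2"
    using u2 by (simp add: v2_def)
  have c: "b1 \<bullet> u1 + b2 \<bullet> v2 = 0"
    using b u2 bu2 by (simp add: v2_def t_def)
  have "M2 *\<^sub>v v2 = e \<cdot>\<^sub>v v2"
    using M u2 by (simp add: v2_def mult_mat_vec smult_smult_assoc mult.commute)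
  then have "coupled_eigenpair M1 a1 b1 M2 a2 b2 e u1 v2"
    using M a u1 v2 by (auto simp: coupled_eigenpair_def Let_def c intro!: eq_vecI)
  then show ?thesis by blast
qed

section \<open>Passage to the algebraic closure\<close>

lemma closure_mat_add_mult_transpose:
  fixes A x y :: "'a::field mat"
  assumes A: "A \<in> carrier_mat n n" and "x \<in> carrier_mat n 1" "y \<in> carrier_mat n 1"
  shows "closure_mat (A + x * transpose_mat y) =
    closure_mat A + outer_product (col (closure_mat x) 0) (col (closure_mat y) 0)"
  using assms
  by (intro eq_matI)
    (auto simp: closure_mat_def outer_product_def scalar_prod_def to_ac_add to_ac_mult)

lemma closure_mat_block_diagonal:
  fixes A1 A2 :: "'a::field mat"
  assumes "A1 \<in> carrier_mat n1 n1" "A2 \<in> carrier_mat n2 n2"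
  shows "closure_mat (four_block_mat A1 (0\<^sub>m n1 n2) (0\<^sub>m n2 n1) A2) =
    four_block_mat (closure_mat A1) (0\<^sub>m n1 n2) (0\<^sub>m n2 n1) (closure_mat A2)"
  using assms by (intro eq_matI) (auto simp: closure_mat_def)

lemma split_block_closure_mat:
  assumes "split_block B k l = (B11, B12, B21, B22)" "k \<le> dim_row B" "l \<le> dim_col B"
  shows "split_block (closure_mat B) k l =
    (closure_mat B11, closure_mat B12, closure_mat B21, closure_mat B22)"
  using assms by (auto simp: split_block_def Let_def closure_mat_def intro!: eq_matI)

lemma split_block_block_diagonal_perturbation:
  fixes M1 M2 :: "'k::field mat"
  assumes M: "M1 \<in> carrier_mat n1 n1" "M2 \<in> carrier_mat n2 n2"
    and a: "a1 \<in> carrier_vec n1" "a2 \<in> carrier_vec n2"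
    and b: "b1 \<in> carrier_vec n1" "b2 \<in> carrier_vec n2"
    and split: "split_block (four_block_mat M1 (0\<^sub>m n1 n2) (0\<^sub>m n2 n1) M2
      + outer_product (a1 @\<^sub>v a2) (b1 @\<^sub>v b2)) n1 n1 = (N11, N12, N21, N22)"
  shows "N11 = M1 + outer_product a1 b1" and "N22 = M2 + outer_product a2 b2"
  using assms
  by (auto simp: split_block_def Let_def outer_product_def append_vec_def intro!: eq_matI)

theorem proposition3p5:
  fixes A A1 A2 B B11 B12 B21 B22 x y :: "'a::field mat"
    and n n1 n2 :: nat
  assumes "n = n1 + n2"
    and "A1 \<in> carrier_mat n1 n1" and "A2 \<in> carrier_mat n2 n2"
    and "A = four_block_mat A1 (0\<^sub>m n1 n2) (0\<^sub>m n2 n1) A2"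
    and "x \<in> carrier_mat n 1" and "y \<in> carrier_mat n 1"
    and "B = A + x * transpose_mat y"
    and "split_block B n1 n1 = (B11, B12, B21, B22)"
    and "\<forall>e \<in> closure_spectrum A1. geom_mult A1 e = 1"
    and "\<forall>e \<in> closure_spectrum A2. geom_mult A2 e = 1"
    and "closure_spectrum A1 \<inter> closure_spectrum B11 = {}"
    and "closure_spectrum A2 \<inter> closure_spectrum B22 = {}"
  shows "closure_spectrum A1 \<inter> closure_spectrum A2 = closure_spectrum B \<inter> closure_spectrum A1
    \<and> closure_spectrum B \<inter> closure_spectrum A1 = closure_spectrum B \<inter> closure_spectrum A2"
proof -
  define M1 where "M1 = closure_mat A1"
  define M2 where "M2 = closure_mat A2"
  define a where "a = col (closure_mat x) 0"
  define b where "b = col (closure_mat y) 0"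
  define a1 where "a1 = vec_first a n1"
  define a2 where "a2 = vec_last a n2"
  define b1 where "b1 = vec_first b n1"
  define b2 where "b2 = vec_last b n2"
  have M: "M1 \<in> carrier_mat n1 n1" "M2 \<in> carrier_mat n2 n2"
    using assms(2,3) by (auto simp: M1_def M2_def closure_mat_def)
  have a: "a1 \<in> carrier_vec n1" "a2 \<in> carrier_vec n2"
    and b: "b1 \<in> carrier_vec n1" "b2 \<in> carrier_vec n2"
    by (simp_all add: a1_def a2_def b1_def b2_def)
  have "a \<in> carrier_vec (n1 + n2)" "b \<in> carrier_vec (n1 + n2)"
    using assms(5,6)
    unfolding a_def b_def closure_mat_def assms(1) by (auto intro!: col_carrier_vec)
  then have ab: "a = a1 @\<^sub>v a2" "b = b1 @\<^sub>v b2"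
    unfolding a1_def a2_def b1_def b2_def by (simp_all only: vec_first_last_append)
  have A: "A \<in> carrier_mat n n"
    using assms(1-4) by auto
  have B: "closure_mat B = four_block_mat M1 (0\<^sub>m n1 n2) (0\<^sub>m n2 n1) M2
      + outer_product (a1 @\<^sub>v a2) (b1 @\<^sub>v b2)"
    unfolding assms(7) closure_mat_add_mult_transpose[OF A assms(5,6)] ab[symmetric]
    by (simp add: assms(4) closure_mat_block_diagonal[OF assms(2,3)] M1_def M2_def a_def b_def)
  have "split_block (closure_mat B) n1 n1 =
      (closure_mat B11, closure_mat B12, closure_mat B21, closure_mat B22)"
    using assms(8) by (rule split_block_closure_mat) (use A assms(1,5-7) in auto)
  then have blocks: "closure_mat B11 = M1 + outer_product a1 b1"
      "closure_mat B22 = M2 + outer_product a2 b2"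
    unfolding B by (rule split_block_block_diagonal_perturbation[OF M a b])+
  have spec: "e \<in> closure_spectrum B \<longleftrightarrow> (\<exists>v1 v2. coupled_eigenpair M1 a1 b1 M2 a2 b2 e v1 v2)"
      "e \<in> closure_spectrum A1 \<longleftrightarrow> eigenvalue M1 e"
      "e \<in> closure_spectrum A2 \<longleftrightarrow> eigenvalue M2 e" for e
    by (simp_all add: closure_spectrum_def spectrum_def B M1_def[symmetric] M2_def[symmetric]
        eigenvalue_block_diagonal_perturbation_iff[OF M a b])
  have moved1: "\<not> eigenvalue (M1 + outer_product a1 b1) e" if "e \<in> closure_spectrum A1" for e
    using that assms(11) by (auto simp: closure_spectrum_def spectrum_def blocks)
  have moved2: "\<not> eigenvalue (M2 + outer_product a2 b2) e" if "e \<in> closure_spectrum A2" for e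
    using that assms(12) by (auto simp: closure_spectrum_def spectrum_def blocks)
  have "e \<in> closure_spectrum A2" if "e \<in> closure_spectrum B" "e \<in> closure_spectrum A1" for e
    using that moved1 coupled_eigenpair_imp_eigenvalue_second[OF M a b] unfolding spec by blast
  moreover have "e \<in> closure_spectrum A1"
    if "e \<in> closure_spectrum B" "e \<in> closure_spectrum A2" for e
    using that moved2
      coupled_eigenpair_imp_eigenvalue_second[OF M(2,1) a(2,1) b(2,1) _ _ coupled_eigenpair_swap]
    unfolding spec by blast
  moreover have "e \<in> closure_spectrum B"
    if "e \<in> closure_spectrum A1" "e \<in> closure_spectrum A2" for e
    using that moved2 common_eigenvalue_imp_coupled_eigenpair[OF M a b] unfolding spec by blast
  ultimately show ?thesis by blast
qed

end
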